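(* Let $m, n$ be integers with $0 < m < n$, and let $E \subset \mathbb{R}^{n}$ be an $m$-rectifiable set which is not essentially $m$-flat. Then $\mathcal{H}^m(\pi_x(E \setminus \{x\})) > 0$ for $\mathcal{H}^m$-almost every $x \in \mathbb{R}^n$. Moreover, the exceptional set $$\{x \in \mathbb{R}^{n} : \mathcal{H}^{m}(\pi_{x}(E \setminus \{x\})) = 0\}$$ is $(m-1)$-flat.
   Context: $\mathcal{H}^m$ denotes $m$-dimensional Hausdorff (outer) measure on $\mathbb{R}^n$, and $\mathbb{S}^{n-1}$ is the unit sphere of $\mathbb{R}^n$. For $x \in \mathbb{R}^n$, the radial projection $\pi_x \colon \mathbb{R}^n \setminus \{x\} \to \mathbb{S}^{n-1}$ is $\pi_x(y) = (y-x)/|y-x|$. A $C^1$-embedding $f \colon \mathbb{R}^m \to \mathbb{R}^n$ is a continuously differentiable map that is a homeomorphism onto its image. An $\mathcal{H}^m$-measurable set $E \subset \mathbb{R}^n$ is called $m$-rectifiable if $\mathcal{H}^m(E) > 0$ and there are countably many $C^1$-embeddings $f_i \colon \mathbb{R}^m \to \mathbb{R}^n$ such that $\mathcal{H}^m\big(E \setminus \bigcup_i f_i(\mathbb{R}^m)\big) = 0$. (Positivity of the measure is part of the definition; finiteness of $\mathcal{H}^m(E)$ is not required.) A $k$-plane is a $k$-dimensional affine subspace of $\mathbb{R}^n$; a $0$-plane is a singleton. A set $A \subset \mathbb{R}^n$ is $k$-flat if there is a $k$-plane $T$ with $A \subset T$ (in particular the empty set is $k$-flat). A set $A$ is essentially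 $k$-flat if there is a $k$-plane $T$ with $\mathcal{H}^k(A \setminus T) = 0$. *)

theory Defs
  imports "HOL-Analysis.Analysis"
begin

text \<open>
  The \<open>m\<close>-dimensional Hausdorff outer measure, with the normalisation
  \<open>unit_ball_vol m / 2 ^ m\<close> that makes it agree with Lebesgue measure on \<open>m\<close>-dimensional
  Euclidean space. The empty set is treated separately only because
  \<open>0 ^ 0 = 1\<close>. Boundedness is required of the covering sets because \<^const>\<open>diameter\<close>
  is meaningless on unbounded sets.
\<close>

definition hausdorff_gauge :: "nat \<Rightarrow> 'a::metric_space set \<Rightarrow> real" where
  "hausdorff_gauge m S = (if S = {} then 0 else unit_ball_vol (real m) * (diameter S / 2) ^ m)"

definition hausdorff_pre :: "nat \<Rightarrow> real \<Rightarrow> 'a::metric_space set \<Rightarrow> ennreal" where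
  "hausdorff_pre m \<delta> A =
     (INF S \<in> {S :: nat \<Rightarrow> 'a set. A \<subseteq> (\<Union>i. S i) \<and> (\<forall>i. bounded (S i) \<and> diameter (S i) \<le> \<delta>)}.
        \<Sum>i. ennreal (hausdorff_gauge m (S i)))"

definition hausdorff_outer :: "nat \<Rightarrow> 'a::metric_space set \<Rightarrow> ennreal" where
  "hausdorff_outer m A = (SUP \<delta> \<in> {0<..}. hausdorff_pre m \<delta> A)"

text \<open>Measurability in the sense of Caratheodory.\<close>

definition hausdorff_measurable :: "nat \<Rightarrow> 'a::metric_space set \<Rightarrow> bool" where
  "hausdorff_measurable m E \<longleftrightarrow> E \<in> lambda_system UNIV UNIV (hausdorff_outer m)"

text \<open>
  For an outer measure, a property holds almost everywhere iff the set where it fails has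
  outer measure zero (such a set is automatically Caratheodory measurable).
\<close>

definition hausdorff_ae :: "nat \<Rightarrow> ('a::metric_space \<Rightarrow> bool) \<Rightarrow> bool" where
  "hausdorff_ae m P \<longleftrightarrow> hausdorff_outer m {x. \<not> P x} = 0"

text \<open>No immersion condition is imposed on \<open>C\<^sup>1\<close>-embeddings.\<close>

definition C1_embedding :: "(real ^ 'm \<Rightarrow> real ^ 'n) \<Rightarrow> bool" where
  "C1_embedding f \<longleftrightarrow>
     (\<exists>f' :: real ^ 'm \<Rightarrow> (real ^ 'm) \<Rightarrow>\<^sub>L (real ^ 'n).
        (\<forall>x. (f has_derivative blinfun_apply (f' x)) (at x)) \<and> continuous_on UNIV f') \<and>
     (\<exists>g. homeomorphism UNIV (range f) f g)"

text \<open>The dimension \<open>m\<close> of the rectifiable set is \<open>CARD('m)\<close>, passed as a type argument.\<close>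

definition rectifiable :: "'m::finite itself \<Rightarrow> (real ^ 'n) set \<Rightarrow> bool" where
  "rectifiable (_ :: 'm itself) E \<longleftrightarrow>
     hausdorff_measurable CARD('m) E \<and>
     hausdorff_outer CARD('m) E > 0 \<and>
     (\<exists>F :: (real ^ 'm \<Rightarrow> real ^ 'n) set.
        countable F \<and> (\<forall>f\<in>F. C1_embedding f) \<and>
        hausdorff_outer CARD('m) (E - (\<Union>f\<in>F. range f)) = 0)"

definition is_plane :: "nat \<Rightarrow> 'a::euclidean_space set \<Rightarrow> bool" where
  "is_plane k T \<longleftrightarrow> affine T \<and> aff_dim T = int k"

definition flat :: "nat \<Rightarrow> 'a::euclidean_space set \<Rightarrow> bool" where
  "flat k A \<longleftrightarrow> (\<exists>T. is_plane k T \<and> A \<subseteq> T)"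

definition essentially_flat :: "nat \<Rightarrow> 'a::euclidean_space set \<Rightarrow> bool" where
  "essentially_flat k A \<longleftrightarrow> (\<exists>T. is_plane k T \<and> hausdorff_outer k (A - T) = 0)"

text \<open>Only meaningful for \<open>y \<noteq> x\<close>.\<close>

definition radial_proj :: "'a::real_normed_vector \<Rightarrow> 'a \<Rightarrow> 'a" where
  "radial_proj x y = (y - x) /\<^sub>R norm (y - x)"

end

theory Submission
  imports Defs
begin

text \<open>
  Up to a null set, \<open>E\<close> is covered by the images of countably many \<open>C\<^sup>1\<close> maps \<open>f\<close>, and by a
  Sard-type lemma the critical points of \<open>f\<close> contribute nothing. If \<open>D f a\<close> is injective and
  \<open>x\<close> does not lie on the tangent plane \<open>f a + range (D f a)\<close>, then \<open>\<pi>\<^sub>x \<circ> f\<close> has injective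
  derivative at \<open>a\<close>, so it expands distances near \<open>a\<close> up to a constant; hence, if \<open>x\<close> is
  exceptional, such points \<open>f a\<close> of \<open>E\<close> form a null set. If the exceptional set were not
  \<open>(m-1)\<close>-flat, it would contain \<open>m + 1\<close> affinely independent points. At almost every point
  of \<open>E\<close> all of them lie on the \<open>m\<close>-dimensional tangent plane, which is therefore their affine
  hull \<open>T\<close>. So almost all of \<open>E\<close> lies in \<open>T\<close>, and \<open>E\<close> is essentially \<open>m\<close>-flat.
\<close>

section \<open>Hausdorff content\<close>

text \<open>
  For \<open>m > 0\<close> the content has the same null sets as the Hausdorff measure, because covers of
  small total size automatically consist of sets of small diameter. This allows all estimates
  to ignore the bound \<open>\<delta>\<close> on the diameters.
\<close>

definition hausdorff_content :: "nat \<Rightarrow> 'a::metric_space set \<Rightarrow> ennreal" where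
  "hausdorff_content m A =
     (INF S \<in> {S :: nat \<Rightarrow> 'a set. A \<subseteq> (\<Union>i. S i) \<and> (\<forall>i. bounded (S i))}.
        \<Sum>i. ennreal (diameter (S i) ^ m))"

lemma hausdorff_content_le:
  assumes "A \<subseteq> (\<Union>i. S i)" "\<And>i. bounded (S i)"
  shows "hausdorff_content m A \<le> (\<Sum>i. ennreal (diameter (S i) ^ m))"
  unfolding hausdorff_content_def by (rule INF_lower) (use assms in auto)

lemma hausdorff_content_lessE:
  assumes "hausdorff_content m A < b"
  obtains S where "A \<subseteq> (\<Union>i. S i)" "\<And>i. bounded (S i)"
    "(\<Sum>i. ennreal (diameter (S i) ^ m)) < b"
  using assms unfolding hausdorff_content_def INF_less_iff by auto

lemma hausdorff_content_mono: "A \<subseteq> B \<Longrightarrow> hausdorff_content m A \<le> hausdorff_content m B"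
  unfolding hausdorff_content_def by (rule INF_superset_mono) auto

lemma hausdorff_content_null_subset:
  "A \<subseteq> B \<Longrightarrow> hausdorff_content m B = 0 \<Longrightarrow> hausdorff_content m A = 0"
  using hausdorff_content_mono[of A B m] by auto

section \<open>Countable subadditivity of the content\<close>

lemma suminf_ennreal_geometric:
  assumes "0 \<le> e" shows "(\<Sum>i. ennreal (e * (1/2) ^ Suc i)) = ennreal e"
proof -
  have "(\<lambda>i. e * (1/2) ^ Suc i) sums (e * 1)"
    by (intro sums_mult power_half_series)
  then show ?thesis
    using assms by (subst suminf_ennreal_eq[where x = e]) auto
qed

text \<open>Each \<open>A i\<close> is covered with an excess of at most
  \<open>e / 2 ^ (i + 1)\<close>, and the resulting double sequence of sets is arranged into one
  sequence by \<open>prod_decode\<close>.\<close>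

lemma hausdorff_content_UN_le:
  fixes A :: "nat \<Rightarrow> 'a::metric_space set"
  shows "hausdorff_content m (\<Union>i. A i) \<le> (\<Sum>i. hausdorff_content m (A i))"
proof (rule ennreal_le_epsilon)
  fix e :: real
  assume fin: "(\<Sum>i. hausdorff_content m (A i)) < top" and e: "0 < e"
  have "\<exists>S. A i \<subseteq> (\<Union>j. S j) \<and> (\<forall>j. bounded (S j)) \<and>
          (\<Sum>j. ennreal (diameter (S j) ^ m)) \<le> hausdorff_content m (A i) + ennreal (e * (1/2) ^ Suc i)" for i
  proof -
    have "hausdorff_content m (A i) < top"
      using fin ennreal_suminf_lessD by blast
    \<comment> \<open>Adding a positive term is a strict increase only because the content is finite
      here; strictness is what yields an actual cover.\<close>
    then have "hausdorff_content m (A i) < hausdorff_content m (A i) + ennreal (e * (1/2) ^ Suc i)"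
      using e ennreal_add_left_cancel_less[of "hausdorff_content m (A i)" 0 "ennreal (e * (1/2) ^ Suc i)"]
      by simp
    then show ?thesis
      by (elim hausdorff_content_lessE) (blast intro: less_imp_le)
  qed
  then obtain S where S: "\<And>i. A i \<subseteq> (\<Union>j. S i j)" "\<And>i j. bounded (S i j)"
    "\<And>i. (\<Sum>j. ennreal (diameter (S i j) ^ m)) \<le> hausdorff_content m (A i) + ennreal (e * (1/2) ^ Suc i)"
    by metis
  define T where "T k = (case prod_decode k of (i, j) \<Rightarrow> S i j)" for k
  have "hausdorff_content m (\<Union>i. A i) \<le> (\<Sum>k. ennreal (diameter (T k) ^ m))"
  proof (rule hausdorff_content_le)
    show "(\<Union>i. A i) \<subseteq> (\<Union>k. T k)"
    proof
      fix x assume "x \<in> (\<Union>i. A i)"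
      then obtain i j where "x \<in> S i j" using S(1) by blast
      then have "x \<in> T (prod_encode (i, j))" by (simp add: T_def)
      then show "x \<in> (\<Union>k. T k)" by blast
    qed
  qed (auto simp: T_def S(2) split: prod.split)
  also have "\<dots> = (\<Sum>k. (\<lambda>(i, j). ennreal (diameter (S i j) ^ m)) (prod_decode k))"
    by (simp add: T_def split_def)
  also have "\<dots> = (\<Sum>i. \<Sum>j. ennreal (diameter (S i j) ^ m))"
    by (rule suminf_ennreal_2dimen) simp
  also have "\<dots> \<le> (\<Sum>i. hausdorff_content m (A i) + ennreal (e * (1/2) ^ Suc i))"
    by (intro suminf_le S summableI)
  also have "\<dots> = (\<Sum>i. hausdorff_content m (A i)) + (\<Sum>i. ennreal (e * (1/2) ^ Suc i))"
    by (intro suminf_add[symmetric] summableI)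
  also have "\<dots> = (\<Sum>i. hausdorff_content m (A i)) + ennreal e"
    using e by (subst suminf_ennreal_geometric) auto
  finally show "hausdorff_content m (\<Union>i. A i) \<le> (\<Sum>i. hausdorff_content m (A i)) + ennreal e" .
qed

lemma hausdorff_content_le_diameter:
  assumes "bounded A" "0 < m"
  shows "hausdorff_content m A \<le> ennreal (diameter A ^ m)"
proof -
  \<comment> \<open>Empty sets pad the cover to a sequence; they cost nothing, since
    \<open>diameter {} = 0\<close> and \<open>0 ^ m = 0\<close> for \<open>0 < m\<close>.\<close>
  define S :: "nat \<Rightarrow> 'a set" where "S i = (if i = 0 then A else {})" for i
  have "hausdorff_content m A \<le> (\<Sum>i. ennreal (diameter (S i) ^ m))"
    by (rule hausdorff_content_le) (auto simp: S_def assms intro: exI[of _ 0])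
  also have "\<dots> = (\<Sum>i\<in>{0::nat}. ennreal (diameter (S i) ^ m))"
    by (rule suminf_finite) (auto simp: S_def assms)
  finally show ?thesis by (simp add: S_def)
qed

lemma hausdorff_content_empty [simp]: "0 < m \<Longrightarrow> hausdorff_content m {} = 0"
  using hausdorff_content_le_diameter[of "{}" m] by (simp add: zero_power)

text \<open>The sum over a countable index set is written as an integral over counting measure, the
  form in which \<open>emeasure_UN_countable\<close> adds up the disjoint balls of a Vitali family
  below.\<close>

lemma hausdorff_content_countable_UN_le:
  assumes "countable I" "0 < m"
  shows "hausdorff_content m (\<Union>i\<in>I. A i) \<le> (\<integral>\<^sup>+i. hausdorff_content m (A i) \<partial>count_space I)"
proof -
  let ?J = "to_nat_on I ` I"
  define B where "B n = (if n \<in> ?J then A (from_nat_into I n) else {})" for n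
  have bij: "bij_betw (from_nat_into I) ?J I"
    using assms(1) by (simp add: bij_betw_def inj_on_def image_image)
  have "(\<Union>i\<in>I. A i) \<subseteq> (\<Union>n. B n)"
  proof
    fix x assume "x \<in> (\<Union>i\<in>I. A i)"
    then obtain i where "i \<in> I" "x \<in> A i" by auto
    then have "x \<in> B (to_nat_on I i)" using assms(1) by (simp add: B_def)
    then show "x \<in> (\<Union>n. B n)" by blast
  qed
  then have "hausdorff_content m (\<Union>i\<in>I. A i) \<le> (\<Sum>n. hausdorff_content m (B n))"
    by (rule order_trans[OF hausdorff_content_mono hausdorff_content_UN_le])
  also have "\<dots> = (\<integral>\<^sup>+n. hausdorff_content m (A (from_nat_into I n)) * indicator ?J n \<partial>count_space UNIV)"
    unfolding nn_integral_count_space_nat using assms(2)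
    by (intro suminf_cong) (auto simp: B_def indicator_def)
  also have "\<dots> = (\<integral>\<^sup>+n. hausdorff_content m (A (from_nat_into I n)) \<partial>count_space ?J)"
    by (rule nn_integral_count_space_indicator[symmetric]) simp
  also have "\<dots> = (\<integral>\<^sup>+i. hausdorff_content m (A i) \<partial>count_space I)"
    by (rule nn_integral_bij_count_space[OF bij])
  finally show ?thesis .
qed

lemma hausdorff_content_countable_UN_null:
  assumes "countable I" "0 < m" "\<And>i. i \<in> I \<Longrightarrow> hausdorff_content m (A i) = 0"
  shows "hausdorff_content m (\<Union>i\<in>I. A i) = 0"
proof -
  have "hausdorff_content m (\<Union>i\<in>I. A i) \<le> (\<integral>\<^sup>+i. 0 \<partial>count_space I)"
    by (rule order_trans[OF hausdorff_content_countable_UN_le])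
      (use assms in \<open>auto intro!: nn_integral_mono simp del: nn_integral_const\<close>)
  then show ?thesis by simp
qed

lemma hausdorff_content_Un_null:
  assumes "0 < m" "hausdorff_content m A = 0" "hausdorff_content m B = 0"
  shows "hausdorff_content m (A \<union> B) = 0"
  using hausdorff_content_countable_UN_null[of "{A, B}" m "\<lambda>X. X"] assms by auto

section \<open>Comparison with the Hausdorff outer measure\<close>

lemma hausdorff_gauge_eq:
  "0 < m \<Longrightarrow> hausdorff_gauge m S = unit_ball_vol (real m) / 2 ^ m * diameter S ^ m"
  by (simp add: hausdorff_gauge_def power_divide)

lemma hausdorff_outer_eq_0_iff:
  assumes "0 < m"
  shows "hausdorff_outer m A = 0 \<longleftrightarrow> hausdorff_content m A = 0"
proof
  define c where "c = unit_ball_vol (real m) / 2 ^ m"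
  have c: "0 < c" by (simp add: c_def)
  have gauge: "(\<Sum>i. ennreal (hausdorff_gauge m (S i))) = ennreal c * (\<Sum>i. ennreal (diameter (S i) ^ m))"
    for S :: "nat \<Rightarrow> 'a set"
    using assms c by (simp add: hausdorff_gauge_eq ennreal_mult' flip: c_def)
  {
    assume "hausdorff_outer m A = 0"
    then have "hausdorff_pre m 1 A = 0"
      using SUP_upper[of 1 "{0<..}" "\<lambda>d. hausdorff_pre m d A"] by (simp add: hausdorff_outer_def)
    show "hausdorff_content m A = 0"
    proof (rule ccontr)
      assume "hausdorff_content m A \<noteq> 0"
      then have "hausdorff_pre m 1 A < ennreal c * hausdorff_content m A"
        using \<open>hausdorff_pre m 1 A = 0\<close> c by (simp add: ennreal_zero_less_mult_iff zero_less_iff_neq_zero)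
      then obtain S where S: "A \<subseteq> (\<Union>i. S i)" "\<And>i. bounded (S i)"
          "(\<Sum>i. ennreal (hausdorff_gauge m (S i))) < ennreal c * hausdorff_content m A"
        unfolding hausdorff_pre_def INF_less_iff by auto
      moreover have "ennreal c * hausdorff_content m A \<le> ennreal c * (\<Sum>i. ennreal (diameter (S i) ^ m))"
        by (intro mult_left_mono hausdorff_content_le S) simp
      ultimately show False by (simp add: gauge)
    qed
  }
  {
    assume 0: "hausdorff_content m A = 0"
    have "hausdorff_pre m d A \<le> 0 + ennreal e" if d: "d > 0" and e: "e > 0" for d e
    proof -
      \<comment> \<open>The bound \<open>d ^ m\<close> on the total forces every single diameter
        below \<open>d\<close>; the bound \<open>e / c\<close> makes the total gauge at most
        \<open>e\<close>.\<close>
      have "hausdorff_content m A < ennreal (min (d ^ m) (e / c))"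
        using d e c 0 by simp
      then obtain S where S: "A \<subseteq> (\<Union>i. S i)" "\<And>i. bounded (S i)"
          "(\<Sum>i. ennreal (diameter (S i) ^ m)) < ennreal (min (d ^ m) (e / c))"
        by (rule hausdorff_content_lessE) blast
      have "diameter (S i) \<le> d" for i
      proof -
        have "ennreal (diameter (S i) ^ m) \<le> (\<Sum>i. ennreal (diameter (S i) ^ m))"
          using sum_le_suminf[of "\<lambda>i. ennreal (diameter (S i) ^ m)" "{i}"] by (simp add: summableI)
        also have "\<dots> \<le> ennreal (d ^ m)"
          using S(3) by (meson ennreal_leI less_imp_le min.cobounded1 order_trans)
        finally have "diameter (S i) ^ m \<le> d ^ m" using d by simp
        then show ?thesis
          using d assms by (simp add: power_mono_iff diameter_ge_0[OF S(2)])
      qed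
      then have "hausdorff_pre m d A \<le> (\<Sum>i. ennreal (hausdorff_gauge m (S i)))"
        unfolding hausdorff_pre_def by (intro INF_lower) (use S in auto)
      also have "\<dots> \<le> ennreal c * ennreal (min (d ^ m) (e / c))"
        unfolding gauge by (rule mult_left_mono[OF less_imp_le[OF S(3)]]) simp
      also have "\<dots> \<le> ennreal e"
      proof -
        have "c * min (d ^ m) (e / c) \<le> c * (e / c)" using c by (intro mult_left_mono) auto
        then show ?thesis using c by (subst ennreal_mult'[symmetric]) (auto intro: ennreal_leI)
      qed
      finally show ?thesis by simp
    qed
    then have "hausdorff_pre m d A \<le> 0" if "d > 0" for d
      by (rule ennreal_le_epsilon) (use that in auto)
    then have "hausdorff_outer m A \<le> 0"
      unfolding hausdorff_outer_def by (intro SUP_least) simp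
    then show "hausdorff_outer m A = 0" by simp
  }
qed

section \<open>Comparison of images under two maps\<close>

lemma diameter_le_dist:
  assumes "0 \<le> d" "\<And>x y. x \<in> S \<Longrightarrow> y \<in> S \<Longrightarrow> dist x y \<le> d"
  shows "diameter S \<le> d"
  using assms by (auto simp: diameter_def intro: cSUP_least)

lemma hausdorff_content_image_le:
  assumes K: "0 \<le> K" "\<And>x y. x \<in> P \<Longrightarrow> y \<in> P \<Longrightarrow> dist (w x) (w y) \<le> K * dist (u x) (u y)"
    and less: "hausdorff_content m (u ` P) < b"
  shows "hausdorff_content m (w ` P) \<le> ennreal (K ^ m) * b"
proof -
  obtain S where S: "u ` P \<subseteq> (\<Union>i. S i)" "\<And>i. bounded (S i)"
    "(\<Sum>i. ennreal (diameter (S i) ^ m)) < b"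
    using less by (rule hausdorff_content_lessE) blast
  define T where "T i = w ` (P \<inter> u -` S i)" for i
  have T: "dist x y \<le> K * diameter (S i)" if "x \<in> T i" "y \<in> T i" for x y i
  proof -
    obtain a b where "a \<in> P" "b \<in> P" "u a \<in> S i" "u b \<in> S i" "x = w a" "y = w b"
      using \<open>x \<in> T i\<close> \<open>y \<in> T i\<close> by (auto simp: T_def)
    then show ?thesis
      using K(2)[of a b] diameter_bounded_bound[OF S(2), of "u a" i "u b"] K(1)
      by (meson mult_left_mono order_trans)
  qed
  have d: "diameter (T i) ^ m \<le> K ^ m * diameter (S i) ^ m" for i
  proof -
    have "diameter (T i) \<le> K * diameter (S i)"
      using K(1) diameter_ge_0[OF S(2)] T by (intro diameter_le_dist) auto
    moreover have "0 \<le> diameter (T i)"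
      using T by (intro diameter_ge_0) (auto simp: bounded_two_points)
    ultimately show ?thesis by (metis power_mono power_mult_distrib)
  qed
  have "hausdorff_content m (w ` P) \<le> (\<Sum>i. ennreal (diameter (T i) ^ m))"
  proof (rule hausdorff_content_le)
    show "w ` P \<subseteq> (\<Union>i. T i)" 
    proof
      fix z assume "z \<in> w ` P"
      then obtain a where "a \<in> P" "z = w a" by blast
      moreover from this obtain i where "u a \<in> S i" using S(1) by blast
      ultimately show "z \<in> (\<Union>i. T i)" unfolding T_def by blast
    qed
    show "bounded (T i)" for i using T by (auto simp: bounded_two_points)
  qed
  also have "\<dots> \<le> (\<Sum>i. ennreal (K ^ m) * ennreal (diameter (S i) ^ m))"
    using d K(1) by (intro suminf_le summableI) (metis ennreal_leI ennreal_mult' zero_le_power)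
  also have "\<dots> = ennreal (K ^ m) * (\<Sum>i. ennreal (diameter (S i) ^ m))" by simp
  also have "\<dots> \<le> ennreal (K ^ m) * b"
    by (rule mult_left_mono[OF less_imp_le[OF S(3)]]) simp
  finally show ?thesis .
qed

lemma hausdorff_content_image_null:
  assumes "0 \<le> K" "\<And>x y. x \<in> P \<Longrightarrow> y \<in> P \<Longrightarrow> dist (w x) (w y) \<le> K * dist (u x) (u y)"
    and "hausdorff_content m (u ` P) = 0"
  shows "hausdorff_content m (w ` P) = 0"
proof -
  have "hausdorff_content m (w ` P) \<le> 0 + ennreal e" if "0 < e" for e
  proof -
    \<comment> \<open>The summand 1 keeps the denominator positive when
      \<open>K ^ m = 0\<close>.\<close>
    have "0 < e / (K ^ m + 1)" using assms(1) that by (simp add: add_nonneg_pos)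
    then have "hausdorff_content m (u ` P) < ennreal (e / (K ^ m + 1))"
      using assms(3) by (metis ennreal_less_zero_iff)
    then have "hausdorff_content m (w ` P) \<le> ennreal (K ^ m) * ennreal (e / (K ^ m + 1))"
      using assms(1,2) by (intro hausdorff_content_image_le)
    also have "\<dots> = ennreal (K ^ m * (e / (K ^ m + 1)))"
      using assms(1) by (intro ennreal_mult'[symmetric]) simp
    also have "\<dots> \<le> ennreal e"
    proof (rule ennreal_leI)
      have "0 \<le> K ^ m" using assms(1) by simp
      then show "K ^ m * (e / (K ^ m + 1)) \<le> e"
        using that by (simp add: pos_divide_le_eq add_nonneg_pos algebra_simps)
    qed
    finally show ?thesis by simp
  qed
  then have "hausdorff_content m (w ` P) \<le> 0" by (rule ennreal_le_epsilon)
  then show ?thesis by simp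
qed

text \<open>Constant and radius in \<open>loc\<close> may vary with the point. Countably many pieces
  suffice to make them uniform, and on each piece \<open>hausdorff_content_image_null\<close>
  applies.\<close>

lemma hausdorff_content_null_transfer:
  fixes A :: "'a::{metric_space, second_countable_topology} set"
  assumes m: "0 < m"
    and loc: "\<And>a. a \<in> A \<Longrightarrow>
      \<exists>K. \<exists>d>0. \<forall>y\<in>A. dist y a < d \<longrightarrow> dist (w y) (w a) \<le> K * dist (u y) (u a)"
    and null: "hausdorff_content m (u ` A) = 0"
  shows "hausdorff_content m (w ` A) = 0"
proof -
  obtain D :: "'a set" where D: "countable D" "\<And>X. open X \<Longrightarrow> X \<noteq> {} \<Longrightarrow> \<exists>d\<in>D. d \<in> X"
    using countable_dense_exists by metis
  \<comment> \<open>The number \<open>k\<close> bounds both the Lipschitz constant and the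
    reciprocal of the scale. Membership in a ball of radius \<open>1 / (2 * (k + 1))\<close> around
    \<open>q\<close> puts any two points of a piece within the distance \<open>1 / (k + 1)\<close>
    at which the estimate holds.\<close>
  define P where "P = (\<lambda>(k::nat, q). {a \<in> A \<inter> ball q (1 / (2 * (k + 1))).
    \<forall>y\<in>A. dist y a < 1 / (k + 1) \<longrightarrow> dist (w y) (w a) \<le> k * dist (u y) (u a)})"
  have "A \<subseteq> (\<Union>i \<in> UNIV \<times> D. P i)"
  proof
    fix a assume a: "a \<in> A"
    then obtain K d where K: "d > 0" "\<And>y. y \<in> A \<Longrightarrow> dist y a < d \<Longrightarrow> dist (w y) (w a) \<le> K * dist (u y) (u a)"
      using loc by blast
    obtain k :: nat where k: "max K (1 / d) < k" using reals_Archimedean2 by blast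
    obtain q where q: "q \<in> D" "q \<in> ball a (1 / (2 * (real k + 1)))"
      using D(2)[of "ball a (1 / (2 * (real k + 1)))"] by auto
    have "1 / (real k + 1) < d" using k K(1) by (simp add: field_simps)
    moreover have "K * dist (u y) (u a) \<le> k * dist (u y) (u a)" for y
      using k by (intro mult_right_mono) auto
    ultimately have "dist (w y) (w a) \<le> k * dist (u y) (u a)" if "y \<in> A" "dist y a < 1 / (real k + 1)" for y
      using K(2)[OF that(1)] that(2) by (meson less_trans order_trans)
    then have "a \<in> P (k, q)"
      using q(2) a by (auto simp: P_def dist_commute add.commute)
    then show "a \<in> (\<Union>i \<in> UNIV \<times> D. P i)" using q(1) by blast
  qed
  then have sub: "w ` A \<subseteq> (\<Union>i \<in> UNIV \<times> D. w ` P i)" by blast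
  have "hausdorff_content m (w ` P i) = 0" for i
  proof -
    obtain k q where i: "i = (k, q)" by fastforce
    show ?thesis
    proof (rule hausdorff_content_image_null[of "real k"])
      fix x y assume xy: "x \<in> P i" "y \<in> P i"
      have "dist x y < 1 / (2 * (real k + 1)) + 1 / (2 * (real k + 1))"
        using xy dist_triangle3[of x y q] by (auto simp: P_def i)
      also have "\<dots> = 1 / (real k + 1)" by (simp add: field_simps)
      finally show "dist (w x) (w y) \<le> k * dist (u x) (u y)"
        using xy by (auto simp: P_def i)
    next
      show "hausdorff_content m (u ` P i) = 0"
        by (rule hausdorff_content_null_subset[OF _ null]) (auto simp: P_def i)
    qed simp
  qed
  then have "hausdorff_content m (\<Union>i \<in> UNIV \<times> D. w ` P i) = 0"
    using D(1) m by (intro hausdorff_content_countable_UN_null) auto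
  with sub show ?thesis by (rule hausdorff_content_null_subset)
qed

section \<open>Content of images of smooth maps\<close>

lemma hausdorff_content_image_le_emeasure:
  fixes f :: "'a::euclidean_space \<Rightarrow> 'b::metric_space"
  assumes m: "0 < m" and U: "open U" "S \<subseteq> U"
    and small: "\<And>x d. x \<in> S \<Longrightarrow> 0 < d \<Longrightarrow>
      \<exists>r. 0 < r \<and> r < d \<and> hausdorff_content m (f ` cball x (5 * r)) \<le> c * emeasure lborel (cball x r)"
  shows "hausdorff_content m (f ` S) \<le> c * emeasure lborel U"
proof -
  have "\<exists>r. 0 < r \<and> r \<le> 1 \<and> cball x r \<subseteq> U \<and>
      hausdorff_content m (f ` cball x (5 * r)) \<le> c * emeasure lborel (cball x r)" if x: "x \<in> S" for x
  proof -
    have "x \<in> U" using U x by blast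
    then obtain e where e: "e > 0" "cball x e \<subseteq> U"
      using U(1) by (metis open_contains_cball)
    \<comment> \<open>The bound \<open>e\<close> keeps the ball inside \<open>U\<close>; the bound 1
      is the uniform bound on radii that the covering lemma asks for.\<close>
    obtain r where "0 < r" "r < min e 1"
      "hausdorff_content m (f ` cball x (5 * r)) \<le> c * emeasure lborel (cball x r)"
      using small[OF x, of "min e 1"] e by auto
    moreover from this have "cball x r \<subseteq> cball x e" by auto
    ultimately show ?thesis using e by (intro exI[of _ r]) auto
  qed
  then obtain r where r: "\<And>x. x \<in> S \<Longrightarrow> 0 < r x" "\<And>x. x \<in> S \<Longrightarrow> r x \<le> 1"
    "\<And>x. x \<in> S \<Longrightarrow> cball x (r x) \<subseteq> U"
    "\<And>x. x \<in> S \<Longrightarrow> hausdorff_content m (f ` cball x (5 * r x)) \<le> c * emeasure lborel (cball x (r x))"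
    by metis
  obtain C where C: "countable C" "C \<subseteq> S"
    "pairwise (\<lambda>i j. disjnt (cball i (r i)) (cball j (r j))) C"
    "S \<subseteq> (\<Union>i\<in>C. cball i (5 * r i))"
  proof (rule Vitali_covering_lemma_cballs[where S = S and K = S and a = "\<lambda>x. x" and r = r and B = 1])
    show "S \<subseteq> (\<Union>i\<in>S. cball i (r i))" using r(1) by force
  qed (use r in auto)
  have "hausdorff_content m (f ` S) \<le> hausdorff_content m (\<Union>i\<in>C. f ` cball i (5 * r i))"
    using C(4) by (intro hausdorff_content_mono) blast
  also have "\<dots> \<le> (\<integral>\<^sup>+i. hausdorff_content m (f ` cball i (5 * r i)) \<partial>count_space C)"
    by (rule hausdorff_content_countable_UN_le[OF C(1) m])
  also have "\<dots> \<le> (\<integral>\<^sup>+i. c * emeasure lborel (cball i (r i)) \<partial>count_space C)"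
    using r(4) C(2) by (intro nn_integral_mono) auto
  also have "\<dots> = c * (\<integral>\<^sup>+i. emeasure lborel (cball i (r i)) \<partial>count_space C)"
    by (rule nn_integral_cmult) simp
  also have "(\<integral>\<^sup>+i. emeasure lborel (cball i (r i)) \<partial>count_space C) = emeasure lborel (\<Union>i\<in>C. cball i (r i))"
    using C(1,3) by (intro emeasure_UN_countable[symmetric])
      (auto simp: disjoint_family_on_def pairwise_def disjnt_def)
  also have "c * \<dots> \<le> c * emeasure lborel U"
    using r(3) C(2) U(1) by (intro mult_left_mono emeasure_mono) auto
  finally show ?thesis .
qed

text \<open>The covering estimate is applied to the identity map and an open superset of
  \<open>S\<close> of small measure.\<close>

lemma negligible_imp_hausdorff_content_null:
  fixes S :: "'a::euclidean_space set"
  assumes "negligible S"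
  shows "hausdorff_content DIM('a) S = 0"
proof -
  let ?m = "DIM('a)"
  \<comment> \<open>This is the ratio of \<open>(10 * r) ^ ?m\<close>, the cost of covering
    \<open>cball x (5 * r)\<close> by itself, to the volume of \<open>cball x r\<close>.\<close>
  define c where "c = 10 ^ ?m / unit_ball_vol (real ?m)"
  have c: "0 < c" by (simp add: c_def)
  have "hausdorff_content ?m S \<le> 0 + ennreal e" if e: "0 < e" for e
  proof -
    have S: "S \<in> sets lebesgue" "emeasure lebesgue S = 0"
      using assms by (auto simp: negligible_iff_null_sets)
    obtain T where T: "open T" "S \<subseteq> T" "T - S \<in> lmeasurable" "emeasure lebesgue (T - S) < ennreal (e / c)"
      using sets_lebesgue_outer_open[OF S(1)] e c by (metis divide_pos_pos)
    have "emeasure lborel T = emeasure lebesgue (S \<union> (T - S))"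
      using T(1,2) by (simp add: Un_absorb1)
    also have "\<dots> \<le> ennreal (e / c)"
    proof -
      have "emeasure lebesgue (S \<union> (T - S)) \<le> emeasure lebesgue S + emeasure lebesgue (T - S)"
        using S(1) T(3) by (intro emeasure_subadditive) auto
      then show ?thesis using S(2) T(4) by simp
    qed
    finally have T': "emeasure lborel T \<le> ennreal (e / c)" .
    have "hausdorff_content ?m ((\<lambda>x. x) ` S) \<le> ennreal c * emeasure lborel T"
    proof (rule hausdorff_content_image_le_emeasure[OF _ T(1,2)])
      fix x :: 'a and d :: real assume d: "0 < d"
      have "hausdorff_content ?m (cball x (5 * (d/2))) \<le> ennreal ((10 * (d/2)) ^ ?m)"
        using hausdorff_content_le_diameter[of "cball x (5 * (d/2))" ?m] d by (simp add: diameter_cball)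
      also have "\<dots> = ennreal c * emeasure lborel (cball x (d/2))"
      proof -
        have "(10 * (d/2)) ^ ?m = c * (unit_ball_vol (real ?m) * (d/2) ^ ?m)"
          using unit_ball_vol_pos[of "real ?m", THEN less_imp_neq] by (simp add: c_def power_mult_distrib del: times_divide_eq_right)
        then show ?thesis
          using d c unit_ball_vol_nonneg[of "real ?m"] by (simp add: emeasure_cball flip: ennreal_mult)
      qed
      finally show "\<exists>r. 0 < r \<and> r < d \<and>
        hausdorff_content ?m ((\<lambda>x. x) ` cball x (5 * r)) \<le> ennreal c * emeasure lborel (cball x r)"
        using d by (intro exI[of _ "d/2"]) auto
    qed simp
    also have "\<dots> \<le> ennreal c * ennreal (e / c)" by (intro mult_left_mono T') simp
    also have "\<dots> = ennreal e" using c e by (simp flip: ennreal_mult)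
    finally show ?thesis by simp
  qed
  then have "hausdorff_content ?m S \<le> 0" by (rule ennreal_le_epsilon)
  then show ?thesis by simp
qed

section \<open>Linear images and critical values\<close>

lemma hausdorff_content_linear_image_null:
  fixes L :: "'a::euclidean_space \<Rightarrow> 'b::real_normed_vector"
  assumes "linear L" "negligible S"
  shows "hausdorff_content DIM('a) (L ` S) = 0"
proof -
  obtain K where K: "K > 0" "\<And>x. norm (L x) \<le> norm x * K"
    using bounded_linear.pos_bounded[OF linear_conv_bounded_linear[THEN iffD1, OF assms(1)]] by blast
  show ?thesis
  proof (rule hausdorff_content_image_null[of K S L "\<lambda>x. x"])
    show "dist (L x) (L y) \<le> K * dist x y" for x y
      using K(2)[of "x - y"] assms(1) by (simp add: dist_norm linear_diff mult.commute)
  qed (use K negligible_imp_hausdorff_content_null[OF assms(2)] in auto)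
qed

text \<open>Projecting along a kernel vector \<open>v\<close> onto its orthogonal hyperplane does
  not change the value of \<open>L\<close>, so the range is already the image of a negligible
  set.\<close>

lemma hausdorff_content_singular_range_null:
  fixes L :: "'a::euclidean_space \<Rightarrow> 'b::real_normed_vector"
  assumes L: "linear L" and "\<not> inj L"
  shows "hausdorff_content DIM('a) (range L) = 0"
proof -
  obtain v where v: "v \<noteq> 0" "L v = 0"
    using assms(2) linear_injective_0[OF L] by blast
  have "L x \<in> L ` {x. v \<bullet> x = 0}" for x
  proof
    show "L x = L (x - ((v \<bullet> x) / (v \<bullet> v)) *\<^sub>R v)"
      using v L by (simp add: linear_diff linear_scale)
    show "x - ((v \<bullet> x) / (v \<bullet> v)) *\<^sub>R v \<in> {x. v \<bullet> x = 0}"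
      using v by (simp add: inner_diff_right)
  qed
  then have "range L \<subseteq> L ` {x. v \<bullet> x = 0}" by blast
  moreover have "hausdorff_content DIM('a) (L ` {x. v \<bullet> x = 0}) = 0"
    using L v(1) by (intro hausdorff_content_linear_image_null negligible_hyperplane) auto
  ultimately show ?thesis by (rule hausdorff_content_null_subset)
qed

text \<open>The sets of a cheap cover are thickened to open sets at an extra cost of at most
  \<open>e / 2\<close> in total; by compactness the open cover contains a neighbourhood of
  \<open>P\<close> of uniform radius.\<close>

lemma hausdorff_content_compact_neighbourhood:
  assumes P: "compact P" "hausdorff_content m P = 0" and e: "0 < e"
  obtains t where "0 < t" "hausdorff_content m (\<Union>x\<in>P. cball x t) \<le> ennreal e"
proof -
  have "hausdorff_content m P < ennreal (e/2)" using P(2) e by simp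
  then obtain S where S: "P \<subseteq> (\<Union>i. S i)" "\<And>i. bounded (S i)"
    "(\<Sum>i. ennreal (diameter (S i) ^ m)) < ennreal (e/2)"
    by (rule hausdorff_content_lessE) blast
  have "\<exists>s>0. (diameter (S i) + 2 * s) ^ m < diameter (S i) ^ m + (e/2) * (1/2) ^ Suc i" for i
  proof -
    \<comment> \<open>The thickening \<open>s i\<close> is found by continuity of the cost in
      \<open>s\<close> at 0.\<close>
    have "((\<lambda>s. (diameter (S i) + 2 * s) ^ m) \<longlongrightarrow> (diameter (S i) + 2 * 0) ^ m) (at_right 0)"
      by (intro tendsto_intros)
    then have "eventually (\<lambda>s. (diameter (S i) + 2 * s) ^ m < diameter (S i) ^ m + (e/2) * (1/2) ^ Suc i) (at_right 0)"
      by (rule order_tendstoD(2)) (use e in simp)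
    then have "eventually (\<lambda>s. 0 < s \<and> (diameter (S i) + 2 * s) ^ m < diameter (S i) ^ m + (e/2) * (1/2) ^ Suc i) (at_right (0::real))"
      by (intro eventually_conj eventually_at_right_less)
    then show ?thesis
      by (auto dest: eventually_happens)
  qed
  then obtain s where s: "\<And>i. 0 < s i"
    "\<And>i. (diameter (S i) + 2 * s i) ^ m < diameter (S i) ^ m + (e/2) * (1/2) ^ Suc i"
    by metis
  define T where "T i = (\<Union>x\<in>S i. ball x (s i))" for i
  have T: "dist x y \<le> diameter (S i) + 2 * s i" if xy: "x \<in> T i" "y \<in> T i" for x y i
  proof -
    obtain a b where ab: "a \<in> S i" "b \<in> S i" "dist a x < s i" "dist b y < s i"
      using xy by (auto simp: T_def)
    have "dist x y \<le> dist a x + dist a b + dist b y"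
      by (smt (verit) dist_commute dist_triangle)
    then show ?thesis
      using ab diameter_bounded_bound[OF S(2) ab(1,2)] by linarith
  qed
  have d: "diameter (T i) ^ m \<le> diameter (S i) ^ m + (e/2) * (1/2) ^ Suc i" for i
  proof -
    have "diameter (T i) \<le> diameter (S i) + 2 * s i"
      using s(1)[of i] diameter_ge_0[OF S(2)[of i]] T by (intro diameter_le_dist) auto
    moreover have "0 \<le> diameter (T i)"
      using T by (intro diameter_ge_0) (auto simp: bounded_two_points)
    ultimately have "diameter (T i) ^ m \<le> (diameter (S i) + 2 * s i) ^ m" by (rule power_mono)
    then show ?thesis using s(2)[of i] by linarith
  qed
  have "P \<subseteq> (\<Union>i. T i)"
  proof
    fix x assume "x \<in> P"
    then obtain i where "x \<in> S i" using S(1) by blast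
    then have "x \<in> T i" unfolding T_def using s(1)[of i] by (intro UN_I[of x]) auto
    then show "x \<in> (\<Union>i. T i)" by blast
  qed
  then obtain t where t: "0 < t" "(\<Union>x\<in>P. cball x t) \<subseteq> (\<Union>i. T i)"
    using P(1) by (elim compact_subset_open_imp_cball_epsilon_subset) (auto simp: T_def)
  have "hausdorff_content m (\<Union>x\<in>P. cball x t) \<le> (\<Sum>i. ennreal (diameter (T i) ^ m))"
    using t(2) by (rule hausdorff_content_le) (use T in \<open>auto simp: bounded_two_points\<close>)
  also have "\<dots> \<le> (\<Sum>i. ennreal (diameter (S i) ^ m) + ennreal ((e/2) * (1/2) ^ Suc i))"
  proof (intro suminf_le summableI)
    fix i
    show "ennreal (diameter (T i) ^ m) \<le> ennreal (diameter (S i) ^ m) + ennreal ((e/2) * (1/2) ^ Suc i)"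
      using ennreal_leI[OF d[of i]] e diameter_ge_0[OF S(2)[of i]]
      by (subst ennreal_plus[symmetric]) auto
  qed
  also have "\<dots> = (\<Sum>i. ennreal (diameter (S i) ^ m)) + (\<Sum>i. ennreal ((e/2) * (1/2) ^ Suc i))"
    by (intro suminf_add[symmetric] summableI)
  also have "\<dots> = (\<Sum>i. ennreal (diameter (S i) ^ m)) + ennreal (e/2)"
    using e by (subst suminf_ennreal_geometric) auto
  also have "\<dots> \<le> ennreal (e/2) + ennreal (e/2)"
    by (intro add_right_mono less_imp_le S)
  also have "\<dots> = ennreal e" using e by (simp flip: ennreal_plus)
  finally show ?thesis using t(1) that by blast
qed

text \<open>
  Near a critical point \<open>x\<close>, the image of the ball of radius \<open>5 r\<close> is, up to translation and
  scaling by \<open>r\<close>, contained in a small neighbourhood of the compact null set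
  \<open>D x ` cball 0 5\<close>, so its content is small compared with \<open>r ^ m\<close>.
\<close>

lemma hausdorff_content_critical_values_null:
  fixes f :: "'a::euclidean_space \<Rightarrow> 'b::euclidean_space"
  assumes deriv: "\<And>x. x \<in> S \<Longrightarrow> (f has_derivative D x) (at x)"
    and sing: "\<And>x. x \<in> S \<Longrightarrow> \<not> inj (D x)"
  shows "hausdorff_content DIM('a) (f ` S) = 0"
proof -
  let ?m = "DIM('a)" and ?w = "unit_ball_vol (real DIM('a))"
  have w: "0 < ?w" by simp
  \<comment> \<open>Cutting down to a ball gives the covering estimate an open set of finite
    measure; as \<open>c\<close> is arbitrary, the content then vanishes.\<close>
  have le: "hausdorff_content ?m (f ` (S \<inter> ball 0 (real k))) \<le> ennreal c * emeasure lborel (ball (0::'a) (real k))"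
    if c: "0 < c" for c k
  proof (rule hausdorff_content_image_le_emeasure)
    fix x :: 'a and d :: real
    assume "x \<in> S \<inter> ball 0 (real k)" and d: "0 < d"
    then have x: "x \<in> S" by simp
    have lin: "linear (D x)" using deriv[OF x] by (rule has_derivative_linear)
    define P where "P = D x ` cball 0 5"
    have "compact P"
      unfolding P_def by (intro compact_continuous_image linear_continuous_on compact_cball)
        (use lin linear_conv_bounded_linear in blast)
    moreover have "hausdorff_content ?m P = 0"
      by (rule hausdorff_content_null_subset[OF _ hausdorff_content_singular_range_null[OF lin sing[OF x]]])
        (auto simp: P_def)
    \<comment> \<open>Half of the target \<open>c * ?w\<close>, because
      \<open>hausdorff_content_image_le\<close> asks for a strict bound.\<close>
    moreover have "0 < c * ?w / 2" using c w by simp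
    ultimately obtain t where t: "0 < t"
      "hausdorff_content ?m (\<Union>x\<in>P. cball x t) \<le> ennreal (c * ?w / 2)"
      by (rule hausdorff_content_compact_neighbourhood)
    define N where "N = (\<Union>x\<in>P. cball x t)"
    \<comment> \<open>On a ball of radius \<open>5 * r\<close>, the relative error
      \<open>t / 5\<close> amounts to at most \<open>t * r\<close>, which is \<open>t\<close> after
      rescaling by \<open>r\<close>.\<close>
    obtain s where s: "0 < s" "\<And>y. norm (y - x) < s \<Longrightarrow> norm (f y - f x - D x (y - x)) \<le> t / 5 * norm (y - x)"
      using deriv[OF x] t(1) unfolding has_derivative_at_alt by (metis divide_pos_pos zero_less_numeral)
    define r where "r = min (d / 2) (s / 6)"
    have r: "0 < r" "r < d" "5 * r < s" using d s(1) by (auto simp: r_def min_def)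
    have "f ` cball x (5 * r) \<subseteq> (\<lambda>z. f x + r *\<^sub>R z) ` N"
    proof
      fix z assume "z \<in> f ` cball x (5 * r)"
      then obtain y where y: "z = f y" "norm (y - x) \<le> 5 * r"
        by (auto simp: dist_norm norm_minus_commute)
      have "norm (f y - f x - D x (y - x)) \<le> t / 5 * norm (y - x)"
        using s(2) y(2) r(3) by auto
      also have "\<dots> \<le> t / 5 * (5 * r)" using y(2) t(1) by (intro mult_left_mono) auto
      finally have err: "norm (f y - f x - D x (y - x)) \<le> t * r" by simp
      have "dist (D x ((y - x) /\<^sub>R r)) ((f y - f x) /\<^sub>R r) = norm ((f y - f x - D x (y - x)) /\<^sub>R r)"
        using lin by (simp add: dist_norm linear_scale norm_minus_commute flip: scaleR_diff_right)
      also have "\<dots> \<le> t" using err r(1) by (simp add: pos_divide_le_eq divide_inverse_commute[symmetric])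
      finally have "(f y - f x) /\<^sub>R r \<in> cball (D x ((y - x) /\<^sub>R r)) t" by simp
      moreover have "D x ((y - x) /\<^sub>R r) \<in> P"
        unfolding P_def using y(2) r(1) by (intro imageI) (simp add: pos_divide_le_eq divide_inverse_commute[symmetric])
      ultimately have "(f y - f x) /\<^sub>R r \<in> N" unfolding N_def by blast
      moreover have "z = f x + r *\<^sub>R ((f y - f x) /\<^sub>R r)" using r(1) y(1) by simp
      ultimately show "z \<in> (\<lambda>z. f x + r *\<^sub>R z) ` N" by blast
    qed
    then have "hausdorff_content ?m (f ` cball x (5 * r)) \<le> hausdorff_content ?m ((\<lambda>z. f x + r *\<^sub>R z) ` N)"
      by (rule hausdorff_content_mono)
    also have "\<dots> \<le> ennreal (r ^ ?m) * ennreal (c * ?w)"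
    proof (rule hausdorff_content_image_le[where u = "\<lambda>z. z"])
      show "dist (f x + r *\<^sub>R y) (f x + r *\<^sub>R z) \<le> r * dist y z" for y z
        using r(1) by (simp add: dist_norm flip: scaleR_diff_right)
      have "ennreal (c * ?w / 2) < ennreal (c * ?w)"
        using c w by (intro ennreal_lessI) auto
      then show "hausdorff_content ?m ((\<lambda>z. z) ` N) < ennreal (c * ?w)"
        using t(2) by (simp add: N_def)
    qed (use r in simp)
    also have "\<dots> = ennreal c * emeasure lborel (cball x r)"
      using c w r(1) by (simp add: emeasure_cball mult_ac flip: ennreal_mult)
    finally show "\<exists>r. 0 < r \<and> r < d \<and>
        hausdorff_content ?m (f ` cball x (5 * r)) \<le> ennreal c * emeasure lborel (cball x r)"
      using r by blast
  qed auto
  have "hausdorff_content ?m (f ` (S \<inter> ball 0 (real k))) = 0" for k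
  proof -
    define B where "B = measure lborel (ball (0::'a) (real k))"
    have B: "emeasure lborel (ball (0::'a) (real k)) = ennreal B" "0 \<le> B"
      using emeasure_lborel_ball_finite[of "0::'a" "real k"]
      by (auto simp: B_def intro!: emeasure_eq_ennreal_measure)
    have "hausdorff_content ?m (f ` (S \<inter> ball 0 (real k))) \<le> 0 + ennreal e" if e: "0 < e" for e
    proof -
      have "hausdorff_content ?m (f ` (S \<inter> ball 0 (real k))) \<le> ennreal (e / (B + 1)) * ennreal B"
        using le[of "e / (B + 1)" k] e B by (simp add: add_nonneg_pos)
      also have "\<dots> = ennreal (e / (B + 1) * B)"
        using B(2) e by (intro ennreal_mult[symmetric]) auto
      also have "\<dots> \<le> ennreal e"
        using B(2) e by (intro ennreal_leI) (simp add: pos_divide_le_eq add_nonneg_pos algebra_simps)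
      finally show ?thesis by simp
    qed
    then have "hausdorff_content ?m (f ` (S \<inter> ball 0 (real k))) \<le> 0" by (rule ennreal_le_epsilon)
    then show ?thesis by simp
  qed
  then have "hausdorff_content ?m (\<Union>k\<in>(UNIV::nat set). f ` (S \<inter> ball 0 (real k))) = 0"
    by (intro hausdorff_content_countable_UN_null) auto
  moreover have "f ` S \<subseteq> (\<Union>k\<in>(UNIV::nat set). f ` (S \<inter> ball 0 (real k)))"
  proof
    fix z assume "z \<in> f ` S"
    then obtain x where x: "x \<in> S" "z = f x" by blast
    moreover obtain k :: nat where "norm x < k" using reals_Archimedean2 by blast
    ultimately show "z \<in> (\<Union>k\<in>(UNIV::nat set). f ` (S \<inter> ball 0 (real k)))"
      by (intro UN_I[of k]) auto
  qed
  ultimately show ?thesis using hausdorff_content_null_subset by blast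
qed

section \<open>Radial projections\<close>

lemma has_derivative_locally_lipschitz:
  assumes "(f has_derivative D) (at a)"
  obtains K d where "0 < d" "\<And>y. norm (y - a) < d \<Longrightarrow> norm (f y - f a) \<le> K * norm (y - a)"
proof -
  have D: "bounded_linear D" using assms by (rule has_derivative_bounded_linear)
  obtain K where K: "\<And>h. norm (D h) \<le> norm h * K"
    using bounded_linear.bounded[OF D] by blast
  obtain d where d: "0 < d" "\<And>y. norm (y - a) < d \<Longrightarrow> norm (f y - f a - D (y - a)) \<le> 1 * norm (y - a)"
    using assms unfolding has_derivative_at_alt by (metis zero_less_one)
  show ?thesis
  proof (rule that[OF d(1)])
    fix y assume "norm (y - a) < d"
    then have "norm (f y - f a - D (y - a)) \<le> norm (y - a)" using d(2) by simp
    then show "norm (f y - f a) \<le> (K + 1) * norm (y - a)"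
      using K[of "y - a"] norm_triangle_sub[of "f y - f a" "D (y - a)"] by (simp add: algebra_simps)
  qed
qed

text \<open>An injective linear map satisfies \<open>B * norm h \<le> norm (D h)\<close>; near
  \<open>a\<close> the linearisation error consumes at most half of this.\<close>

lemma has_derivative_inj_locally_expanding:
  fixes f :: "'a::euclidean_space \<Rightarrow> 'b::euclidean_space"
  assumes "(f has_derivative D) (at a)" "inj D"
  obtains c d where "0 < c" "0 < d" "\<And>y. norm (y - a) < d \<Longrightarrow> c * norm (y - a) \<le> norm (f y - f a)"
proof -
  have "linear D" using assms(1) by (rule has_derivative_linear)
  then obtain B where B: "0 < B" "\<And>h. B * norm h \<le> norm (D h)"
    using linear_inj_bounded_below_pos assms(2) by blast
  obtain d where d: "0 < d" "\<And>y. norm (y - a) < d \<Longrightarrow> norm (f y - f a - D (y - a)) \<le> B / 2 * norm (y - a)"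
    using assms(1) B(1) unfolding has_derivative_at_alt by (metis half_gt_zero)
  show ?thesis
  proof (rule that[of "B / 2" d])
    fix y assume "norm (y - a) < d"
    then show "B / 2 * norm (y - a) \<le> norm (f y - f a)"
      using d(2)[of y] B(2)[of "y - a"] norm_triangle_sub[of "D (y - a)" "f y - f a"]
      by (simp add: norm_minus_commute)
  qed (use B d in auto)
qed

text \<open>
  The derivative \<open>G\<close> of the projection is not computed: differentiating
  \<open>f y = x + \<bar>f y - x\<bar> \<pi>\<^sub>x (f y)\<close> shows that \<open>G h = 0\<close> forces \<open>D h\<close> to be parallel to \<open>f a - x\<close>.
\<close>

lemma radial_proj_derivative_inj:
  fixes f :: "'a::euclidean_space \<Rightarrow> 'b::euclidean_space"
  assumes f: "(f has_derivative D) (at a)" and inj: "inj D" and x: "x \<notin> range (\<lambda>h. f a + D h)"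
  obtains G where "((\<lambda>y. radial_proj x (f y)) has_derivative G) (at a)" "inj G"
proof -
  have lin: "linear D" using f by (rule has_derivative_linear)
  have ne: "f a \<noteq> x" using x linear_0[OF lin] rangeI[of "\<lambda>h. f a + D h" 0] by auto
  define \<rho> where "\<rho> y = norm (f y - x)" for y
  have fd: "(\<lambda>y. f y - x) differentiable (at a)"
    using f by (intro differentiable_diff differentiable_const) (rule differentiableI)
  have \<rho>d: "\<rho> differentiable (at a)"
    unfolding \<rho>_def using differentiable_chain_at[OF fd, of norm] ne
    by (simp add: o_def)
  obtain \<rho>' where \<rho>': "(\<rho> has_derivative \<rho>') (at a)"
    using \<rho>d unfolding differentiable_def by blast
  have \<rho>a: "\<rho> a > 0" using ne by (simp add: \<rho>_def)
  have "((\<lambda>y. inverse (\<rho> y)) has_derivative (\<lambda>h. - (inverse (\<rho> a) * \<rho>' h * inverse (\<rho> a)))) (at a)"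
    by (rule Deriv.has_derivative_inverse[OF _ \<rho>']) (use \<rho>a in simp)
  from has_derivative_scaleR[OF this has_derivative_diff[OF f has_derivative_const[of x]]]
  obtain G where "((\<lambda>y. inverse (\<rho> y) *\<^sub>R (f y - x)) has_derivative G) (at a)" by blast
  then have G: "((\<lambda>y. radial_proj x (f y)) has_derivative G) (at a)"
    by (simp add: \<rho>_def radial_proj_def)
  \<comment> \<open>Where \<open>f y = x\<close> the factor \<open>\<rho> y\<close> is 0, so the
    identity holds everywhere and both sides can be differentiated at \<open>a\<close>.\<close>
  have "f y = x + \<rho> y *\<^sub>R radial_proj x (f y)" for y
    by (cases "f y = x") (auto simp: \<rho>_def radial_proj_def)
  then have "f = (\<lambda>y. x + \<rho> y *\<^sub>R radial_proj x (f y))" by blast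
  moreover have "((\<lambda>y. x + \<rho> y *\<^sub>R radial_proj x (f y)) has_derivative
      (\<lambda>h. 0 + (\<rho> a *\<^sub>R G h + \<rho>' h *\<^sub>R radial_proj x (f a)))) (at a)"
    by (intro has_derivative_add has_derivative_const has_derivative_scaleR \<rho>' G)
  ultimately have "D = (\<lambda>h. 0 + (\<rho> a *\<^sub>R G h + \<rho>' h *\<^sub>R radial_proj x (f a)))"
    using has_derivative_unique f by metis
  then have D: "D h = \<rho> a *\<^sub>R G h + \<rho>' h *\<^sub>R radial_proj x (f a)" for h by simp
  have "h = 0" if h: "G h = 0" for h
  proof (rule ccontr)
    assume "h \<noteq> 0"
    define c where "c = \<rho>' h / \<rho> a"
    have Dh: "D h = c *\<^sub>R (f a - x)"
      by (simp add: D h c_def radial_proj_def \<rho>_def divide_inverse)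
    have "D h \<noteq> 0" using inj \<open>h \<noteq> 0\<close> linear_injective_0[OF lin] by blast
    then have "c \<noteq> 0" using Dh by auto
    \<comment> \<open>Solving \<open>D h = c (f a - x)\<close> for \<open>x\<close> puts
      \<open>x\<close> on the tangent plane.\<close>
    then have "x = f a + D ((- inverse c) *\<^sub>R h)"
      using Dh lin by (simp add: linear_scale linear_neg)
    then show False using x by blast
  qed
  then have "inj G"
    using linear_injective_0[OF has_derivative_linear[OF G]] by blast
  with G show ?thesis by (rule that)
qed

text \<open>Near \<open>a\<close>, \<open>f\<close> moves by at most \<open>K * norm (y - a)\<close>
  and its projection by at least \<open>c * norm (y - a)\<close>. Hence \<open>f\<close> is
  controlled by its projection with constant \<open>\<bar>K\<bar> / c\<close>, and null sets
  transfer back.\<close>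

lemma hausdorff_content_null_of_radial_proj:
  fixes f :: "'a::euclidean_space \<Rightarrow> 'b::euclidean_space"
  assumes m: "0 < m" and f: "\<And>a. a \<in> A \<Longrightarrow> (f has_derivative D a) (at a)"
    and inj: "\<And>a. a \<in> A \<Longrightarrow> inj (D a)"
    and x: "\<And>a. a \<in> A \<Longrightarrow> x \<notin> range (\<lambda>h. f a + D a h)"
    and null: "hausdorff_content m (radial_proj x ` f ` A) = 0"
  shows "hausdorff_content m (f ` A) = 0"
proof (rule hausdorff_content_null_transfer[OF m])
  show "hausdorff_content m ((\<lambda>a. radial_proj x (f a)) ` A) = 0"
    using null by (simp add: image_image)
  fix a assume a: "a \<in> A"
  obtain G where "((\<lambda>y. radial_proj x (f y)) has_derivative G) (at a)" "inj G"
    using radial_proj_derivative_inj[OF f[OF a] inj[OF a] x[OF a]] .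
  then obtain c d where c: "0 < c" "0 < d"
    "\<And>y. norm (y - a) < d \<Longrightarrow> c * norm (y - a) \<le> norm (radial_proj x (f y) - radial_proj x (f a))"
    by (rule has_derivative_inj_locally_expanding) blast
  obtain K e where K: "0 < e" "\<And>y. norm (y - a) < e \<Longrightarrow> norm (f y - f a) \<le> K * norm (y - a)"
    using has_derivative_locally_lipschitz[OF f[OF a]] by blast
  have "dist (f y) (f a) \<le> \<bar>K\<bar> / c * dist (radial_proj x (f y)) (radial_proj x (f a))"
    if y: "dist y a < min d e" for y
  proof -
    have "norm (f y - f a) \<le> K * norm (y - a)" using K(2) y by (simp add: dist_norm)
    also have "\<dots> \<le> \<bar>K\<bar> * norm (y - a)" by (intro mult_right_mono) auto
    also have "\<dots> = \<bar>K\<bar> / c * (c * norm (y - a))" using c(1) by simp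
    also have "\<dots> \<le> \<bar>K\<bar> / c * norm (radial_proj x (f y) - radial_proj x (f a))"
      using c y by (intro mult_left_mono c(3)) (auto simp: dist_norm)
    finally show ?thesis by (simp add: dist_norm)
  qed
  then show "\<exists>K. \<exists>d>0. \<forall>y\<in>A. dist y a < d \<longrightarrow>
      dist (f y) (f a) \<le> K * dist (radial_proj x (f y)) (radial_proj x (f a))"
    using c(2) K(1) by (intro exI[of _ "\<bar>K\<bar> / c"] exI[of _ "min d e"]) auto
qed

section \<open>Planes\<close>

text \<open>A translate of \<open>T\<close> is a linear image of a proper subspace of
  \<open>'a\<close>, which is negligible there.\<close>

lemma hausdorff_content_plane_null:
  fixes T :: "'b::euclidean_space set"
  assumes T: "is_plane k T" and k: "k < DIM('a::euclidean_space)"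
  shows "hausdorff_content DIM('a) T = 0"
proof -
  have aff: "affine T" "aff_dim T = int k" using T by (auto simp: is_plane_def)
  then have "T \<noteq> {}" by auto
  then obtain a where a: "a \<in> T" by blast
  define V where "V = (+) (- a) ` T"
  have "subspace V" unfolding V_def using aff(1) a by (rule affine_diffs_subspace)
  have "dim V = k" using aff(2) aff_dim_eq_dim[of a T] a by (simp add: V_def hull_inc)
  obtain W :: "'a set" where W: "subspace W" "dim W = k"
    using choose_subspace_of_subspace[of k "UNIV :: 'a set"] k by auto
  obtain f g where "linear f" "linear (g :: 'b \<Rightarrow> 'a)" and f: "f ` W = V"
    using isometries_subspaces[of W V] W \<open>subspace V\<close> \<open>dim V = k\<close> by metis
  have "negligible W" using W k by (intro negligible_lowdim) simp
  then have "hausdorff_content DIM('a) V = 0"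
    using hausdorff_content_linear_image_null[OF \<open>linear f\<close>] f by blast
  then have "hausdorff_content DIM('a) ((+) a ` V) = 0"
    by (intro hausdorff_content_image_null[of 1 V "(+) a" "\<lambda>x. x"]) auto
  then show ?thesis by (simp add: V_def image_image)
qed

text \<open>Since \<open>is_plane\<close> demands dimension exactly \<open>k\<close>, a set of
  smaller dimension is enlarged by points outside its affine hull, one dimension at a time;
  \<open>k \<le> DIM('a)\<close> guarantees that such points exist.\<close>

lemma flatI_aff_dim:
  fixes A :: "'a::euclidean_space set"
  assumes "aff_dim A \<le> int k" "k \<le> DIM('a)"
  shows "flat k A"
  using assms(1)
proof (induction "nat (int k - aff_dim A)" arbitrary: A)
  case 0
  then have "is_plane k (affine hull A)" by (simp add: is_plane_def)
  then show ?case unfolding flat_def by (intro exI[of _ "affine hull A"] conjI hull_subset)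
next
  case (Suc n)
  then have less: "aff_dim A < int k" by linarith
  have "affine hull A \<noteq> UNIV"
  proof
    assume "affine hull A = UNIV"
    then have "aff_dim A = int DIM('a)" by (metis aff_dim_UNIV aff_dim_affine_hull)
    then show False using less assms(2) by simp
  qed
  then obtain x where "x \<notin> affine hull A" by blast
  then have "aff_dim (insert x A) = aff_dim A + 1" by (simp add: aff_dim_insert)
  then have "flat k (insert x A)" using Suc less by (intro Suc.hyps) linarith+
  then show ?case by (auto simp: flat_def)
qed

text \<open>The hull of \<open>C\<close> has dimension \<open>DIM('a)\<close> and lies in the
  tangent plane, whose dimension is no larger. The two therefore coincide, and \<open>p\<close> is
  the point of the plane with \<open>h = 0\<close>.\<close>

lemma affine_independent_imp_mem_tangent_plane:
  fixes D :: "'a::euclidean_space \<Rightarrow> 'b::euclidean_space"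
  assumes D: "linear D" and C: "\<not> affine_dependent C" "card C = DIM('a) + 1"
    and sub: "C \<subseteq> range (\<lambda>h. p + D h)"
  shows "p \<in> affine hull C"
proof -
  define W where "W = (+) p ` range D"
  have W: "W = range (\<lambda>h. p + D h)" by (auto simp: W_def)
  have sp: "subspace (range D)" using D by (simp add: linear_subspace_image)
  then have aff: "affine W" unfolding W_def using affine_translation subspace_imp_affine by blast
  have "dim (range D) \<le> DIM('a)" using dim_image_le[OF D, of UNIV] by simp
  then have dimW: "aff_dim W \<le> int DIM('a)"
    unfolding W_def by (simp add: aff_dim_translation_eq aff_dim_subspace[OF sp])
  have hull: "affine hull C \<subseteq> W" using sub aff W by (intro hull_minimal) auto
  have "aff_dim (affine hull C) = int DIM('a)"
    using aff_dim_affine_independent[OF C(1)] C(2) by simp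
  then have "affine hull C = W"
    using hull dimW aff aff_dim_subset[OF hull] C(2)
    by (intro affine_dim_equal) (auto simp: affine_hull_eq_empty)
  moreover have "p \<in> W" using W linear_0[OF D] rangeI[of "\<lambda>h. p + D h" 0] by simp
  ultimately show ?thesis by simp
qed

section \<open>The exceptional set\<close>

theorem theorem2p1:
  fixes E :: "(real ^ 'n) set"
  assumes "CARD('m::finite) < CARD('n)"
    and "rectifiable TYPE('m) E"
    and "\<not> essentially_flat CARD('m) E"
  shows "hausdorff_ae CARD('m)
           (\<lambda>x :: real ^ 'n. hausdorff_outer CARD('m) (radial_proj x ` (E - {x})) > 0) \<and>
         flat (CARD('m) - 1)
           {x :: real ^ 'n. hausdorff_outer CARD('m) (radial_proj x ` (E - {x})) = 0}"
proof -
  let ?m = "CARD('m)"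
  define P where "P = {x. hausdorff_outer ?m (radial_proj x ` (E - {x})) = 0}"
  have m: "0 < ?m" by simp
  note outer_0 = hausdorff_outer_eq_0_iff[OF m]
  have dim: "DIM(real ^ 'm) = ?m" by simp
  obtain F :: "(real ^ 'm \<Rightarrow> real ^ 'n) set" where F: "countable F" "\<And>f. f \<in> F \<Longrightarrow> C1_embedding f"
    "hausdorff_content ?m (E - (\<Union>f\<in>F. range f)) = 0"
    using assms(2) unfolding rectifiable_def outer_0 by blast
  have "\<exists>D. \<forall>a. (f has_derivative D a) (at a)" if f: "f \<in> F" for f
  proof -
    obtain f' :: "real ^ 'm \<Rightarrow> (real ^ 'm) \<Rightarrow>\<^sub>L (real ^ 'n)"
      where "\<forall>a. (f has_derivative blinfun_apply (f' a)) (at a)"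
      using F(2)[OF f] unfolding C1_embedding_def by blast
    then show ?thesis by (intro exI)
  qed
  then obtain D where D: "\<And>f a. f \<in> F \<Longrightarrow> (f has_derivative D f a) (at a)"
    by metis
  have flat: "flat (?m - 1) P"
  proof (rule ccontr)
    assume "\<not> flat (?m - 1) P"
    moreover have "?m - 1 \<le> DIM(real ^ 'n)" using assms(1) by simp
    ultimately have "\<not> aff_dim P \<le> int (?m - 1)"
      using flatI_aff_dim by blast
    \<comment> \<open>An affine basis of \<open>P\<close> has one point more than the dimension,
      hence at least \<open>?m + 1\<close> points.\<close>
    then have "int ?m \<le> aff_dim P" using m by linarith
    moreover obtain B where B: "B \<subseteq> P" "\<not> affine_dependent B" "affine hull P = affine hull B"
      using affine_basis_exists by blast
    ultimately have "?m + 1 \<le> card B"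
      using aff_dim_affine_independent[OF B(2)] aff_dim_affine_hull[of P] aff_dim_affine_hull[of B]
      by simp
    then obtain C where C: "C \<subseteq> B" "card C = ?m + 1" "finite C"
      by (rule obtain_subset_with_card_n)
    have indep: "\<not> affine_dependent C" using B(2) C(1) by (rule affine_independent_subset)
    define T where "T = affine hull C"
    have "is_plane ?m T"
      using aff_dim_affine_independent[OF indep] C(2) by (simp add: is_plane_def T_def)
    \<comment> \<open>Both sets consist of parameters \<open>a\<close>, to which the derivatives are
      attached; in \<open>transversal f x\<close> the tangent plane at \<open>f a\<close> misses
      \<open>x\<close>.\<close>
    define crit where "crit f = {a. \<not> inj (D f a)}" for f
    define transversal where "transversal f x = {a. f a \<in> E \<and> inj (D f a) \<and> x \<notin> range (\<lambda>h. f a + D f a h)}" for f x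
    have sub: "E - T \<subseteq> (E - (\<Union>f\<in>F. range f)) \<union> (\<Union>f\<in>F. f ` crit f \<union> (\<Union>x\<in>C. f ` transversal f x))"
    proof
      fix y assume y: "y \<in> E - T"
      show "y \<in> (E - (\<Union>f\<in>F. range f)) \<union> (\<Union>f\<in>F. f ` crit f \<union> (\<Union>x\<in>C. f ` transversal f x))"
      proof (cases "y \<in> (\<Union>f\<in>F. range f)")
        case True
        then obtain f a where f: "f \<in> F" "y = f a" by blast
        \<comment> \<open>A tangent plane through all of \<open>C\<close> would put
          \<open>y = f a\<close> into \<open>T\<close>.\<close>
        have "\<not> C \<subseteq> range (\<lambda>h. f a + D f a h)"
          using affine_independent_imp_mem_tangent_plane[OF has_derivative_linear[OF D[OF f(1), of a]] indep, where p = "f a"]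
            C(2) y f(2) by (auto simp: T_def)
        then have "a \<in> crit f \<or> (\<exists>x\<in>C. a \<in> transversal f x)"
          using y f(2) by (auto simp: crit_def transversal_def)
        then show ?thesis using f by blast
      qed (use y in blast)
    qed
    have crit: "hausdorff_content ?m (f ` crit f) = 0" if "f \<in> F" for f
      unfolding dim[symmetric] using D[OF that]
      by (rule hausdorff_content_critical_values_null) (simp add: crit_def)
    have transversal: "hausdorff_content ?m (f ` transversal f x) = 0" if f: "f \<in> F" and x: "x \<in> C" for f x
    proof (rule hausdorff_content_null_of_radial_proj[OF m])
      \<comment> \<open>The point \<open>x\<close> has to be excluded because only the projection of
        \<open>E - {x}\<close> is known to be null; if \<open>x = f a\<close>, then \<open>x\<close>
        would lie on the tangent plane at \<open>f a\<close>.\<close>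
      have "x \<notin> f ` transversal f x"
      proof
        assume "x \<in> f ` transversal f x"
        then obtain a where a: "x = f a" "x \<notin> range (\<lambda>h. f a + D f a h)"
          by (auto simp: transversal_def)
        then show False
          using rangeI[of "\<lambda>h. f a + D f a h" 0] linear_0[OF has_derivative_linear[OF D[OF f]]] by simp
      qed
      then have "f ` transversal f x \<subseteq> E - {x}" by (auto simp: transversal_def)
      moreover have "hausdorff_content ?m (radial_proj x ` (E - {x})) = 0"
        using x C(1) B(1) outer_0 by (auto simp: P_def)
      ultimately show "hausdorff_content ?m (radial_proj x ` f ` transversal f x) = 0"
        by (meson hausdorff_content_null_subset image_mono)
    qed (use D[OF f] in \<open>auto simp: transversal_def\<close>)
    have "hausdorff_content ?m (\<Union>f\<in>F. f ` crit f \<union> (\<Union>x\<in>C. f ` transversal f x)) = 0"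
      using crit transversal F(1) C(3) m
      by (intro hausdorff_content_countable_UN_null hausdorff_content_Un_null)
        (auto intro: countable_finite)
    then have "hausdorff_content ?m (E - T) = 0"
      using hausdorff_content_null_subset[OF sub] hausdorff_content_Un_null[OF m F(3)] by blast
    then have "essentially_flat ?m E"
      using \<open>is_plane ?m T\<close> outer_0 unfolding essentially_flat_def by blast
    then show False using assms(3) by simp
  qed
  then obtain T where T: "is_plane (?m - 1) T" "P \<subseteq> T" by (auto simp: flat_def)
  \<comment> \<open>The almost-everywhere claim follows from flatness, as an
    \<open>(?m - 1)\<close>-plane is null in dimension \<open>?m\<close>.\<close>
  have "hausdorff_content ?m T = 0"
    using hausdorff_content_plane_null[where 'a = "real ^ 'm", OF T(1)] by simp
  then have "hausdorff_outer ?m P = 0"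
    using hausdorff_content_null_subset[OF T(2)] outer_0 by blast
  then show ?thesis
    using flat by (simp add: hausdorff_ae_def P_def not_less)
qed

end
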